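(* Let $n\ge 1$ be an integer, let $S$ and $U$ be biorthogonal univariate refinement masks, each with accuracy number at least one, with $U$ interpolatory, and let $G,H:\mathbb{Z}\to\mathbb{R}$ be the filters associated with $S$ and $U$, respectively. Put $a_G=-2^n+2+(2^n-1)G(0)$. Given $y_j:\mathbb{Z}^n\to\mathbb{R}$, define for $k\in\mathbb{Z}^n$ and $\nu\in\Gamma'$ the coarse coefficients $$y_{j-1}(k)=\frac{1}{2^n}\Big(a_G\,y_j(2k)+\sum_{\nu\in\Gamma'}\ \sum_{L\in\mathbb{Z}\setminus\{0\}}G(L)\,y_j(2k+L\nu)\Big)$$ and the wavelet coefficients $$w_{\nu,j-1}(k)=\frac12\Big(y_j(2k+\nu)-\sum_{m\ \mathrm{odd}}H(m)\,y_j(2k+(1-m)\nu)\Big),$$ where the last sum is over all odd integers $m$. Then for every $k\in\mathbb{Z}^n$, $$y_j(2k)=y_{j-1}(k)-\frac{1}{2^{n-1}}\sum_{\nu\in\Gamma'}\sum_{L\in\mathbb{Z}}G(2L+1)\,w_{\nu,j-1}(k+L\nu).$$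
   Context: $\Gamma'=\{0,1\}^n\setminus\{0\}$. A univariate mask is a Laurent trigonometric polynomial in $\omega\in\mathbb{R}$ (a finite linear combination of $e^{-ik\omega}$, $k\in\mathbb{Z}$); a univariate refinement mask is a mask $R$ with $R(0)=1$. The filter $F:\mathbb{Z}\to\mathbb{R}$ associated with a univariate mask $R$ is the finitely supported function determined by $R(\omega)=\frac12\sum_{k\in\mathbb{Z}}F(k)e^{-ik\omega}$ (filters are real-valued). A univariate refinement mask $R$ has accuracy number at least one if $R(\pi)=0$. It is interpolatory if $R(\omega)+R(\omega+\pi)=1$ for all $\omega$; equivalently its filter satisfies $F(0)=1$ and $F(k)=0$ for all nonzero even $k$. Univariate refinement masks $S$ and $U$ are biorthogonal if $\overline{S(\omega)}U(\omega)+\overline{S(\omega+\pi)}U(\omega+\pi)=1$ for all $\omega$. *)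

theory Defs
  imports "HOL-Analysis.Analysis"
begin

definition univariate_mask :: "(real \<Rightarrow> complex) \<Rightarrow> bool" where
  "univariate_mask R \<longleftrightarrow>
     (\<exists>(K :: int set) (c :: int \<Rightarrow> complex). finite K \<and>
       (\<forall>\<omega>. R \<omega> = (\<Sum>k\<in>K. c k * exp (- \<i> * of_int k * of_real \<omega>))))"

definition refinement_mask :: "(real \<Rightarrow> complex) \<Rightarrow> bool" where
  "refinement_mask R \<longleftrightarrow> univariate_mask R \<and> R 0 = 1"

text \<open>
  A filter is a relation here, not a function of the mask: masks may have complex coefficients,
  and only those with real coefficients have a real-valued filter, which is then unique.
\<close>

definition filter_of_mask :: "(real \<Rightarrow> complex) \<Rightarrow> (int \<Rightarrow> real) \<Rightarrow> bool" where
  "filter_of_mask R F \<longleftrightarrow> finite {k. F k \<noteq> 0} \<and>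
     (\<forall>\<omega>. R \<omega> = 1 / 2 * (\<Sum>k | F k \<noteq> 0. of_real (F k) * exp (- \<i> * of_int k * of_real \<omega>)))"

definition accuracy_at_least_one :: "(real \<Rightarrow> complex) \<Rightarrow> bool" where
  "accuracy_at_least_one R \<longleftrightarrow> R pi = 0"

definition interpolatory :: "(real \<Rightarrow> complex) \<Rightarrow> bool" where
  "interpolatory R \<longleftrightarrow> (\<forall>\<omega>. R \<omega> + R (\<omega> + pi) = 1)"

definition biorthogonal :: "(real \<Rightarrow> complex) \<Rightarrow> (real \<Rightarrow> complex) \<Rightarrow> bool" where
  "biorthogonal S U \<longleftrightarrow>
     (\<forall>\<omega>. cnj (S \<omega>) * U \<omega> + cnj (S (\<omega> + pi)) * U (\<omega> + pi) = 1)"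

text \<open>
  The dimension \<open>n\<close> is the cardinality of the index type \<open>'n\<close>, and the lattice of integer points
  is the type \<open>int ^ 'n\<close>.
\<close>

definition Gamma' :: "(int ^ 'n) set" where
  "Gamma' = {\<nu>. \<forall>i. \<nu> $ i \<in> {0, 1}} - {0}"

definition a_coeff :: "nat \<Rightarrow> (int \<Rightarrow> real) \<Rightarrow> real" where
  "a_coeff n G = - (2 ^ n) + 2 + (2 ^ n - 1) * G 0"

text \<open>
  For finitely supported filters only finitely many terms of the infinite sums below are nonzero.
\<close>

definition coarse_coeff ::
  "(int \<Rightarrow> real) \<Rightarrow> (int ^ 'n \<Rightarrow> real) \<Rightarrow> int ^ 'n \<Rightarrow> real" where
  "coarse_coeff G y k =
     1 / 2 ^ CARD('n) *
       (a_coeff CARD('n) G * y (2 *s k) +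
        (\<Sum>\<nu>\<in>Gamma'. \<Sum>\<^sub>\<infinity>L\<in>UNIV - {0}. G L * y (2 *s k + L *s \<nu>)))"

definition wavelet_coeff ::
  "(int \<Rightarrow> real) \<Rightarrow> (int ^ 'n \<Rightarrow> real) \<Rightarrow> int ^ 'n \<Rightarrow> int ^ 'n \<Rightarrow> real" where
  "wavelet_coeff H y \<nu> k =
     1 / 2 * (y (2 *s k + \<nu>) -
       (\<Sum>\<^sub>\<infinity>m\<in>{m. odd m}. H m * y (2 *s k + (1 - m) *s \<nu>)))"

end

(* Along each line 2k + \<int>\<nu> the identity is univariate.  Writing z(t) = y(2k + t\<nu>), biorthogonality reads
   \<Sum>\<^sub>m H(m) G(m+s) = 2\<delta>(s) for even s, and since U is interpolatory the even m contribute only G(s).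
   Hence the sum of the wavelet coefficients against G(2L+1) collapses to half of \<Sum>\<^sub>L G(L) z(L),
   minus z(0), and the choice of a_G cancels everything but y(2k). *)
theory Submission
  imports Defs
begin

section \<open>Uniqueness of the coefficients of a trigonometric polynomial\<close>

lemma integral_exp_int:
  fixes j :: int
  shows "((\<lambda>x. exp (\<i> * of_int j * of_real x)) has_integral (if j = 0 then 2 * pi else 0)) {0..2*pi}"
proof (cases "j = 0")
  case True
  then show ?thesis
    using has_integral_const_real[of "1::complex" 0 "2*pi"] by (simp add: scaleR_conv_of_real)
next
  case False
  let ?F = "\<lambda>x::real. exp (\<i> * of_int j * of_real x) / (\<i> * of_int j)"
  have "((\<lambda>w. exp (\<i> * of_int j * w) / (\<i> * of_int j)) has_field_derivative
      exp (\<i> * of_int j * w)) (at w)" for w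
    using False by (auto intro!: derivative_eq_intros)
  then have "(?F has_vector_derivative exp (\<i> * of_int j * of_real x)) (at x within {0..2*pi})" for x
    by (rule has_vector_derivative_real_field)
  then   have "((\<lambda>x. exp (\<i> * of_int j * of_real x)) has_integral (?F (2*pi) - ?F 0)) {0..2*pi}"
    by (intro fundamental_theorem_of_calculus) auto
  moreover have "exp (\<i> * of_int j * of_real (2*pi)) = (1::complex)"
    using exp_integer_2pi[of "of_int j"] by (simp add: mult_ac)
  ultimately show ?thesis
    using False by simp
qed

text \<open>Orthogonality of the exponentials: multiplying by \<open>exp (\<i> * j * x)\<close> and
  integrating over a period leaves \<open>2 * pi * c j\<close>, while the integrand is identically
  zero.\<close>

lemma trig_polynomial_zero_coeff:
  fixes c :: "int \<Rightarrow> complex"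
  assumes "finite K" and zero: "\<And>\<omega>. (\<Sum>k\<in>K. c k * exp (- \<i> * of_int k * of_real \<omega>)) = 0"
    and "j \<in> K"
  shows "c j = 0"
proof -
  have "((\<lambda>x. \<Sum>k\<in>K. c k * exp (\<i> * of_int (j - k) * of_real x))
      has_integral (\<Sum>k\<in>K. c k * (if j - k = 0 then 2 * pi else 0))) {0..2*pi}"
    by (intro has_integral_sum has_integral_mult_right integral_exp_int assms)
  moreover have "(\<Sum>k\<in>K. c k * exp (\<i> * of_int (j - k) * of_real x)) = 0" for x
  proof -
    have "(\<Sum>k\<in>K. c k * exp (\<i> * of_int (j - k) * of_real x))
      = exp (\<i> * of_int j * of_real x) * (\<Sum>k\<in>K. c k * exp (- \<i> * of_int k * of_real x))"
      by (simp add: sum_distrib_left exp_diff exp_minus field_simps)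
    then show ?thesis
      using zero[of x] by simp
  qed
  moreover have "(\<Sum>k\<in>K. c k * (if j - k = 0 then 2 * pi else 0)) = c j * (2 * pi)"
    using assms(1,3) by (simp add: if_distrib[of of_real] if_distrib[of "(*) _"] cong: if_cong)
  ultimately have "((\<lambda>x::real. 0) has_integral (c j * (2 * pi))) {0..2*pi}"
    by simp
  then show ?thesis
    using has_integral_0_eq by fastforce
qed

section \<open>From identities between masks to identities between filters\<close>

lemma exp_int_shift_pi:
  "exp (- \<i> * of_int k * of_real (\<omega> + pi))
    = (if even k then 1 else - 1) * exp (- \<i> * of_int k * of_real \<omega>)"
proof -
  have "exp (- \<i> * of_int k * of_real (\<omega> + pi))
      = exp (- \<i> * of_int k * of_real \<omega>) * exp (of_int (- k) * (\<i> * of_real pi))"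
    unfolding exp_add[symmetric] by (simp add: algebra_simps)
  also have "exp (of_int (- k) * (\<i> * of_real pi)) = (exp (\<i> * of_real pi) :: complex) powi (- k)"
    by (rule exp_power_int[symmetric])
  also have "\<dots> = (if even k then 1 else - 1)"
    by (simp add: power_int_minus_left)
  finally show ?thesis
    by (simp only: mult.commute)
qed

text \<open>The freedom in \<open>K\<close> allows indices where the filter vanishes, so that
  coefficients can be compared at any prescribed index. The factor 2 clears the normalisation of the
  filter.\<close>

lemma filter_of_mask_eq:
  assumes F: "filter_of_mask R F" and "finite K" and "{k. F k \<noteq> 0} \<subseteq> K"
  shows "2 * R \<omega> = (\<Sum>k\<in>K. of_real (F k) * exp (- \<i> * of_int k * of_real \<omega>))"
proof -
  have R: "R \<omega> = 1 / 2 * (\<Sum>k | F k \<noteq> 0. of_real (F k) * exp (- \<i> * of_int k * of_real \<omega>))"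
    using F by (auto simp: filter_of_mask_def)
  have "2 * R \<omega> = (\<Sum>k | F k \<noteq> 0. of_real (F k) * exp (- \<i> * of_int k * of_real \<omega>))"
    by (subst R) simp
  also have "\<dots> = (\<Sum>k\<in>K. of_real (F k) * exp (- \<i> * of_int k * of_real \<omega>))"
    using assms(2,3) by (intro sum.mono_neutral_left) auto
  finally show ?thesis .
qed

lemma interpolatory_filter:
  assumes "interpolatory U" and F: "filter_of_mask U H" and "even j"
  shows "H j = (if j = 0 then 1 else 0)"
proof -
  \<comment> \<open>Index 0 carries the constant 1 of the interpolation condition; \<open>j\<close>
    is included because its coefficient is read off even when \<open>H j = 0\<close>.\<close>
  define K where "K = insert 0 (insert j {k. H k \<noteq> 0})"
  have "finite K"
    using F by (auto simp: filter_of_mask_def K_def)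
  have U: "2 * U \<omega> = (\<Sum>k\<in>K. of_real (H k) * exp (- \<i> * of_int k * of_real \<omega>))" for \<omega>
    by (rule filter_of_mask_eq[OF F \<open>finite K\<close>]) (auto simp: K_def)
  \<comment> \<open>Coefficients of \<open>2 * U \<omega> + 2 * U (\<omega> + pi) - 2\<close>: the
    shift by pi flips the sign of the odd terms, so these cancel and the even ones double.\<close>
  let ?c = "\<lambda>k. (if even k then 2 * of_real (H k) else 0) - (if k = 0 then 2 else 0 :: complex)"
  have "(\<Sum>k\<in>K. ?c k * exp (- \<i> * of_int k * of_real \<omega>)) = 0" for \<omega>
  proof -
    have "(\<Sum>k\<in>K. ?c k * exp (- \<i> * of_int k * of_real \<omega>))
        = 2 * U \<omega> + 2 * U (\<omega> + pi)
          - (\<Sum>k\<in>K. if k = 0 then 2 else 0)"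
      unfolding U sum.distrib[symmetric] sum_subtractf[symmetric] exp_int_shift_pi
      by (intro sum.cong) (auto simp: algebra_simps)
    also have "\<dots> = 2 * (U \<omega> + U (\<omega> + pi)) - 2"
      using \<open>finite K\<close> by (simp add: K_def)
    also have "\<dots> = 2 * 1 - 2"
      using assms(1) by (simp only: interpolatory_def)
    finally show ?thesis by simp
  qed
  then have "?c j = 0"
    by (rule trig_polynomial_zero_coeff[OF \<open>finite K\<close>]) (simp add: K_def)
  then show ?thesis
    using \<open>even j\<close> by (auto split: if_splits)
qed

text \<open>The Fourier coefficients of \<open>cnj S * U\<close> are correlations of the two
  filters, because conjugation negates the exponents of \<open>S\<close> and fixes the real values
  of \<open>G\<close>. Adding the shift by pi keeps only even lags, hence the parity
  assumption.\<close>

lemma biorthogonal_filters: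
  assumes "biorthogonal S U" and FG: "filter_of_mask S G" and FH: "filter_of_mask U H" and "even j"
  shows "(\<Sum>m | H m \<noteq> 0. H m * G (m + j)) = (if j = 0 then 2 else 0)"
proof -
  define A where "A = {k. G k \<noteq> 0}"
  define B where "B = {k. H k \<noteq> 0}"
  define K where "K = insert 0 (insert (- j) ((\<lambda>(l, m). m - l) ` (A \<times> B)))"
  have fin: "finite A" "finite B" "finite K"
    using FG FH by (auto simp: filter_of_mask_def A_def B_def K_def)
  let ?e = "\<lambda>k \<omega>. exp (- \<i> * of_int k * of_real \<omega>) :: complex"
  have S: "2 * S \<omega> = (\<Sum>l\<in>A. of_real (G l) * ?e l \<omega>)" for \<omega>
    by (rule filter_of_mask_eq[OF FG fin(1)]) (simp add: A_def)
  have U: "2 * U \<omega> = (\<Sum>m\<in>B. of_real (H m) * ?e m \<omega>)" for \<omega>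
    by (rule filter_of_mask_eq[OF FH fin(2)]) (simp add: B_def)
  \<comment> \<open>The coefficient at \<open>s\<close> collects the pairs with
    \<open>m - l = s\<close>. The lag \<open>j\<close> of the statement therefore appears at
    \<open>s = - j\<close>.\<close>
  define d where "d s = (\<Sum>m\<in>B. of_real (H m * G (m - s)) :: complex)" for s
  have SU: "4 * (cnj (S \<omega>) * U \<omega>) = (\<Sum>s\<in>K. d s * ?e s \<omega>)" for \<omega>
  proof -
    have "4 * (cnj (S \<omega>) * U \<omega>) = cnj (2 * S \<omega>) * (2 * U \<omega>)"
      by simp
    also have "\<dots> = (\<Sum>m\<in>B. \<Sum>l\<in>A. of_real (H m * G l) * ?e (m - l) \<omega>)"
      unfolding S U
      by (subst sum.swap) (simp add: sum_product exp_cnj exp_diff exp_minus field_simps)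
    \<comment> \<open>Substitute \<open>s = m - l\<close> for fixed \<open>m\<close>, then widen the
      range to the common set \<open>K\<close> by zero terms so that the two sums can be
      exchanged.\<close>
    also have "\<dots> = (\<Sum>m\<in>B. \<Sum>s\<in>K. of_real (H m * G (m - s)) * ?e s \<omega>)"
    proof (rule sum.cong[OF refl])
      fix m assume "m \<in> B"
      have "(\<Sum>l\<in>A. of_real (H m * G l) * ?e (m - l) \<omega>)
          = (\<Sum>s\<in>(\<lambda>l. m - l) ` A. of_real (H m * G (m - s)) * ?e s \<omega>)"
        by (subst sum.reindex) (auto simp: inj_on_def)
      also have "\<dots> = (\<Sum>s\<in>K. of_real (H m * G (m - s)) * ?e s \<omega>)"
      proof (rule sum.mono_neutral_left[OF fin(3)])
        show "(\<lambda>l. m - l) ` A \<subseteq> K"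
          using \<open>m \<in> B\<close> by (force simp: K_def)
        have "G (m - s) = 0" if "s \<notin> (\<lambda>l. m - l) ` A" for s
          using that by (force simp: A_def image_iff)
        then show "\<forall>s\<in>K - (\<lambda>l. m - l) ` A. of_real (H m * G (m - s)) * ?e s \<omega> = 0"
          by auto
      qed
      finally show "(\<Sum>l\<in>A. of_real (H m * G l) * ?e (m - l) \<omega>)
          = (\<Sum>s\<in>K. of_real (H m * G (m - s)) * ?e s \<omega>)" .
    qed
    also have "\<dots> = (\<Sum>s\<in>K. d s * ?e s \<omega>)"
      by (subst sum.swap) (simp add: d_def sum_distrib_right)
    finally show ?thesis .
  qed
  let ?c = "\<lambda>s. (if even s then 2 * d s else 0) - (if s = 0 then 4 else 0 :: complex)"
  have "(\<Sum>s\<in>K. ?c s * ?e s \<omega>) = 0" for \<omega>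
  proof -
    have "(\<Sum>s\<in>K. ?c s * ?e s \<omega>)
        = 4 * (cnj (S \<omega>) * U \<omega>) + 4 * (cnj (S (\<omega> + pi)) * U (\<omega> + pi))
          - (\<Sum>s\<in>K. if s = 0 then 4 else 0)"
      unfolding SU sum.distrib[symmetric] sum_subtractf[symmetric] exp_int_shift_pi
      by (intro sum.cong) (auto simp: algebra_simps)
    also have "\<dots> = 4 * (cnj (S \<omega>) * U \<omega> + cnj (S (\<omega> + pi)) * U (\<omega> + pi)) - 4"
      using fin(3) by (simp add: K_def)
    also have "\<dots> = 4 * 1 - 4"
      using assms(1) by (simp only: biorthogonal_def)
    finally show ?thesis by simp
  qed
  then have "?c (- j) = 0"
    by (rule trig_polynomial_zero_coeff[OF fin(3)]) (simp add: K_def)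
  then have d: "d (- j) = of_real (if j = 0 then 2 else 0)"
    using \<open>even j\<close> by (auto split: if_splits)
  have "d (- j) = of_real (\<Sum>m\<in>B. H m * G (m + j))"
    by (simp add: d_def)
  then show ?thesis
    unfolding d of_real_eq_iff B_def by (rule sym)
qed

section \<open>The reconstruction identity along a single line\<close>

lemma infsum_eq_sum_superset:
  assumes "finite F" and "F \<subseteq> A" and "\<And>x. x \<in> A - F \<Longrightarrow> f x = 0"
  shows "infsum f A = sum f F"
proof -
  have "infsum f A = infsum f F"
    by (rule infsum_cong_neutral) (use assms in auto)
  then show ?thesis
    using assms(1) by simp
qed

text \<open>The double sum over odd \<open>t = 2 * L + 1\<close> and odd \<open>m\<close> is
  regrouped by the difference \<open>s = t - m\<close>. This is even, so the correlation of
  \<open>G\<close> and \<open>H\<close> at lag \<open>s\<close> is known.\<close>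

lemma univariate_wavelet_sum:
  fixes G H z :: "int \<Rightarrow> real"
  assumes finG: "finite {l. G l \<noteq> 0}" and finH: "finite {m. H m \<noteq> 0}"
    and biorth: "\<And>s. even s \<Longrightarrow> (\<Sum>m | H m \<noteq> 0. H m * G (m + s)) = (if s = 0 then 2 else 0)"
    and interp: "\<And>m. even m \<Longrightarrow> H m = (if m = 0 then 1 else 0)"
  shows "(\<Sum>\<^sub>\<infinity>L\<in>UNIV. G (2 * L + 1) * (1 / 2 * (z (2 * L + 1) - (\<Sum>\<^sub>\<infinity>m\<in>{m. odd m}. H m * z (2 * L + 1 - m)))))
    = 1 / 2 * ((\<Sum>\<^sub>\<infinity>L\<in>UNIV - {0}. G L * z L) + G 0 * z 0) - z 0"
proof -
  define A where "A = {l. G l \<noteq> 0}"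
  define Ao where "Ao = {l\<in>A. odd l}"
  define B where "B = {m. H m \<noteq> 0}"
  define Bo where "Bo = {m\<in>B. odd m}"
  \<comment> \<open>The even indices in play: differences of odd support points, the even support of
    \<open>G\<close> so that \<open>Ao \<union> E\<close> covers all of \<open>A\<close>, and 0,
    where the delta term lives.\<close>
  define E where "E = insert 0 ({l\<in>A. even l} \<union> (\<lambda>(l, m). l - m) ` (Ao \<times> Bo))"
  have fin: "finite A" "finite B" "finite Ao" "finite Bo" "finite E"
    using finG finH by (auto simp: A_def B_def Ao_def Bo_def E_def)
  have evenE: "even s" if "s \<in> E" for s
    using that by (auto simp: E_def Ao_def Bo_def)
  have "0 \<in> E"
    by (simp add: E_def)
  \<comment> \<open>Interpolation leaves 0 as the only even index in the support of
    \<open>H\<close>; removing its term \<open>H 0 * G s = G s\<close> from the biorthogonality sum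
    gives the odd part.\<close>
  have odd_sum: "(\<Sum>m\<in>Bo. H m * G (m + s)) = (if s = 0 then 2 else 0) - G s" if "even s" for s
  proof -
    have "0 \<in> B"
      using interp[of 0] by (simp add: B_def)
    have "B = insert 0 Bo"
    proof -
      have "m = 0" if "m \<in> B" "even m" for m
        using that interp[of m] by (auto simp: B_def split: if_splits)
      then show ?thesis
        using \<open>0 \<in> B\<close> by (auto simp: Bo_def)
    qed
    moreover have "0 \<notin> Bo"
      by (simp add: Bo_def)
    ultimately have "(\<Sum>m\<in>B. H m * G (m + s)) = H 0 * G s + (\<Sum>m\<in>Bo. H m * G (m + s))"
      using fin(4) by simp
    then show ?thesis
      using biorth[OF that] interp[of 0] by (simp add: B_def)
  qed
  have inner: "(\<Sum>\<^sub>\<infinity>m\<in>{m. odd m}. H m * z (t - m)) = (\<Sum>m\<in>Bo. H m * z (t - m))" for t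
    using fin by (intro infsum_eq_sum_superset) (auto simp: Bo_def B_def)
  let ?g = "\<lambda>t. G t * (1 / 2 * (z t - (\<Sum>m\<in>Bo. H m * z (t - m))))"
  \<comment> \<open>\<open>t div 2\<close> recovers \<open>L\<close> from the odd number
    \<open>t = 2 * L + 1\<close>; any other \<open>L\<close> makes the factor
    \<open>G (2 * L + 1)\<close> vanish.\<close>
  have "(\<Sum>\<^sub>\<infinity>L\<in>UNIV. ?g (2 * L + 1)) = (\<Sum>L\<in>(\<lambda>t. t div 2) ` Ao. ?g (2 * L + 1))"
  proof (rule infsum_eq_sum_superset)
    fix L :: int
    assume "L \<in> UNIV - (\<lambda>t. t div 2) ` Ao"
    then have "2 * L + 1 \<notin> Ao"
      by (force simp: image_iff)
    then show "?g (2 * L + 1) = 0"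
      by (simp add: Ao_def A_def)
  qed (use fin in auto)
  also have "\<dots> = (\<Sum>t\<in>Ao. ?g t)"
    by (subst sum.reindex) (auto simp: inj_on_def Ao_def elim!: oddE)
  also have "\<dots> = 1 / 2 * ((\<Sum>t\<in>Ao. G t * z t) - (\<Sum>t\<in>Ao. \<Sum>m\<in>Bo. G t * (H m * z (t - m))))"
    by (simp add: sum_distrib_left sum_subtractf right_diff_distrib sum_divide_distrib diff_divide_distrib)
  also have "(\<Sum>t\<in>Ao. \<Sum>m\<in>Bo. G t * (H m * z (t - m))) = (\<Sum>m\<in>Bo. \<Sum>s\<in>E. H m * G (m + s) * z s)"
  proof (subst sum.swap, rule sum.cong[OF refl])
    fix m assume m: "m \<in> Bo"
    have "(\<Sum>t\<in>Ao. G t * (H m * z (t - m))) = (\<Sum>s\<in>(\<lambda>t. t - m) ` Ao. H m * G (m + s) * z s)"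
      by (subst sum.reindex) (auto simp: inj_on_def mult_ac)
    also have "\<dots> = (\<Sum>s\<in>E. H m * G (m + s) * z s)"
    proof (rule sum.mono_neutral_left[OF fin(5)])
      show "(\<lambda>t. t - m) ` Ao \<subseteq> E"
        using m by (force simp: E_def)
      have "G (m + s) = 0" if "s \<in> E" "s \<notin> (\<lambda>t. t - m) ` Ao" for s
      proof -
        \<comment> \<open>Parity is needed here: missing \<open>Ao\<close> forces \<open>G\<close>
          to vanish only at odd arguments.\<close>
        have "odd (m + s)"
          using m evenE[OF that(1)] by (simp add: Bo_def)
        moreover have "m + s \<notin> Ao"
          using that(2) by (force simp: image_iff)
        ultimately show ?thesis
          by (simp add: Ao_def A_def)
      qed
      then show "\<forall>s\<in>E - (\<lambda>t. t - m) ` Ao. H m * G (m + s) * z s = 0"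
        by auto
    qed
    finally show "(\<Sum>t\<in>Ao. G t * (H m * z (t - m))) = (\<Sum>s\<in>E. H m * G (m + s) * z s)" .
  qed
  also have "\<dots> = (\<Sum>s\<in>E. (\<Sum>m\<in>Bo. H m * G (m + s)) * z s)"
    by (subst sum.swap) (simp add: sum_distrib_right)
  also have "\<dots> = (\<Sum>s\<in>E. (if s = 0 then 2 * z 0 else 0) - G s * z s)"
    by (rule sum.cong[OF refl]) (simp add: odd_sum evenE left_diff_distrib)
  also have "\<dots> = 2 * z 0 - (\<Sum>s\<in>E. G s * z s)"
    using fin(5) \<open>0 \<in> E\<close> by (simp add: sum_subtractf)
  \<comment> \<open>The odd-indexed terms come from the sampled values, the even-indexed ones from
    the prediction by \<open>H\<close>; together they exhaust the support of
    \<open>G\<close>.\<close>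
  also have "1 / 2 * ((\<Sum>t\<in>Ao. G t * z t) - (2 * z 0 - (\<Sum>s\<in>E. G s * z s)))
      = 1 / 2 * (\<Sum>t\<in>Ao \<union> E. G t * z t) - z 0"
  proof -
    have "Ao \<inter> E = {}"
      using evenE by (auto simp: Ao_def)
    then show ?thesis
      using fin by (simp add: sum.union_disjoint)
  qed
  also have "(\<Sum>t\<in>Ao \<union> E. G t * z t) = (\<Sum>t\<in>Ao \<union> E - {0}. G t * z t) + G 0 * z 0"
    using fin(3,5) \<open>0 \<in> E\<close> by (subst sum.remove[of _ 0]) simp_all
  also have "(\<Sum>t\<in>Ao \<union> E - {0}. G t * z t) = (\<Sum>\<^sub>\<infinity>L\<in>UNIV - {0}. G L * z L)"
  proof (rule infsum_eq_sum_superset[symmetric])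
    have "A \<subseteq> Ao \<union> E"
      by (auto simp: Ao_def E_def)
    then show "G L * z L = 0" if "L \<in> UNIV - {0} - (Ao \<union> E - {0})" for L
      using that by (auto simp: A_def)
  qed (use fin in auto)
  finally show ?thesis
    by (simp only: inner)
qed

section \<open>Counting the directions and assembling the lines\<close>

lemma binary_vectors_eq_image:
  "{\<nu> :: int ^ 'n. \<forall>i. \<nu> $ i \<in> {0, 1}} = (\<lambda>A. \<chi> i. if i \<in> A then 1 else 0) ` UNIV"
proof (intro equalityI subsetI)
  fix \<nu> :: "int ^ 'n"
  assume "\<nu> \<in> {\<nu>. \<forall>i. \<nu> $ i \<in> {0, 1}}"
  then have "\<nu> = (\<chi> i. if i \<in> {i. \<nu> $ i = 1} then 1 else 0)"
    by (auto simp: vec_eq_iff)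
  then show "\<nu> \<in> (\<lambda>A. \<chi> i. if i \<in> A then 1 else 0) ` UNIV"
    by blast
qed auto

text \<open>Binary vectors are the indicator vectors of subsets of the index type; discarding the
  zero vector costs one.\<close>

lemma card_Gamma': "card (Gamma' :: (int ^ 'n) set) = 2 ^ CARD('n) - 1"
proof -
  have "inj (\<lambda>A. (\<chi> i. if i \<in> A then 1 else 0) :: int ^ 'n)"
    by (rule injI) (auto simp: vec_eq_iff split: if_splits)
  then have "card {\<nu> :: int ^ 'n. \<forall>i. \<nu> $ i \<in> {0, 1}} = 2 ^ CARD('n)"
    unfolding binary_vectors_eq_image by (simp add: card_image)
  then show ?thesis
    unfolding Gamma'_def by (subst card_Diff_singleton) auto
qed

theorem mainTheorem3:
  fixes S U :: "real \<Rightarrow> complex"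
    and G H :: "int \<Rightarrow> real"
    and y :: "int ^ 'n \<Rightarrow> real"
    and k :: "int ^ 'n"
  assumes "refinement_mask S" and "refinement_mask U"
    and "biorthogonal S U"
    and "accuracy_at_least_one S" and "accuracy_at_least_one U"
    and "interpolatory U"
    and "filter_of_mask S G" and "filter_of_mask U H"
  shows "y (2 *s k) =
    coarse_coeff G y k -
      1 / 2 ^ (CARD('n) - 1) *
        (\<Sum>\<nu>\<in>Gamma'. \<Sum>\<^sub>\<infinity>L\<in>UNIV. G (2 * L + 1) * wavelet_coeff H y \<nu> (k + L *s \<nu>))"
proof -
  have fin: "finite {l. G l \<noteq> 0}" "finite {m. H m \<noteq> 0}"
    using assms(7,8) by (simp_all add: filter_of_mask_def)
  define T where "T \<nu> = (\<Sum>\<^sub>\<infinity>L\<in>UNIV - {0}. G L * y (2 *s k + L *s \<nu>))" for \<nu>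
  have line: "(\<Sum>\<^sub>\<infinity>L\<in>UNIV. G (2 * L + 1) * wavelet_coeff H y \<nu> (k + L *s \<nu>))
      = 1 / 2 * (T \<nu> + G 0 * y (2 *s k)) - y (2 *s k)" for \<nu>
  proof -
    \<comment> \<open>Every value of \<open>y\<close> in these wavelet coefficients lies on the line
      through \<open>2 *s k\<close> in direction \<open>\<nu>\<close>: the sample at parameter
      \<open>2 * L + 1\<close>, the predictors at \<open>2 * L + 1 - m\<close>.\<close>
    have shift1: "2 *s (k + L *s \<nu>) + \<nu> = 2 *s k + (2 * L + 1) *s \<nu>" for L
      by (simp add: vec_eq_iff algebra_simps)
    have shift2: "2 *s (k + L *s \<nu>) + (1 - m) *s \<nu> = 2 *s k + (2 * L + 1 - m) *s \<nu>" for L m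
      by (simp add: vec_eq_iff algebra_simps)
    show ?thesis
      using univariate_wavelet_sum[where z = "\<lambda>t. y (2 *s k + t *s \<nu>)", OF fin
          biorthogonal_filters[OF assms(3,7,8)] interpolatory_filter[OF assms(6,8)]]
      by (simp only: wavelet_coeff_def shift1 shift2 T_def vector_smult_lzero add_0_right)
  qed
  define N :: real where "N = 2 ^ CARD('n)"
  have N: "N > 0" and half: "1 / 2 ^ (CARD('n) - 1) = 2 / N"
    using power_eq_if[of "2::real" "CARD('n)"] by (auto simp: N_def)
  have card: "real (card (Gamma' :: (int ^ 'n) set)) = N - 1"
    by (simp add: card_Gamma' N_def of_nat_diff)
  have "(\<Sum>\<nu>\<in>Gamma'. 1 / 2 * (T \<nu> + G 0 * y (2 *s k)) - y (2 *s k))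
      = (\<Sum>\<nu>\<in>Gamma'. 1 / 2 * T \<nu> + (1 / 2 * G 0 - 1) * y (2 *s k))"
    by (simp add: algebra_simps)
  also have "\<dots> = 1 / 2 * (\<Sum>\<nu>\<in>Gamma'. T \<nu>) + (N - 1) * ((1 / 2 * G 0 - 1) * y (2 *s k))"
    by (simp only: sum.distrib sum_distrib_left sum_constant card)
  finally have total: "(\<Sum>\<nu>\<in>Gamma'. 1 / 2 * (T \<nu> + G 0 * y (2 *s k)) - y (2 *s k)) = \<dots>" .
  \<comment> \<open>The sums of \<open>T\<close> cancel. With \<open>N\<close> the number of binary
    vectors, the coefficient of \<open>y (2 *s k)\<close> is \<open>(- N + 2 + (N - 1) * G 0) / N -
    2 / N * (N - 1) * (G 0 / 2 - 1) = 1\<close>, which explains the form of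
    \<open>a_coeff\<close>.\<close>
  show ?thesis
    unfolding line total half coarse_coeff_def a_coeff_def T_def[symmetric] N_def[symmetric]
    using N
    by (simp add: field_simps)
qed

end
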